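(* Let $\mathbb{D}\in\mathbb{R}^{M\times M}$ be a symmetric or skew-symmetric matrix with $\mathbb{D}+\mathbb{D}^T\le 0$, let $r\ge 1$, and let $\mathbf{Y}_r\in\mathbf{V}_\tau^r$ be the solution of the continuous time Galerkin method: $\mathbf{Y}_r(0)=\mathbf{Y}_0$ and $\mathbf{Y}_r'=\mathbb{D}\mathcal{P}_{r-1}\mathbf{Y}_r+\mathcal{P}_{r-1}\mathbf{R}$ in $I_n$, $0\le n\le N-1$. Then $$\|\mathbf{Y}_r\|_{L^2(0,T)}\le T^{1/2}\|\mathbf{Y}_0\|_{\mathbb{R}^M}+CT\|\mathbf{R}\|_{L^2(0,T)},$$ $$\max_{0\le t\le T}\|\mathbf{Y}_r(t)\|_{\mathbb{R}^M}\le Cr\left(\|\mathbf{Y}_0\|_{\mathbb{R}^M}+T^{1/2}\|\mathbf{R}\|_{L^2(0,T)}\right),$$ where the constant $C$ is independent of $\tau,r,\mathbb{D}$, and $\mathbf{R}$.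
   Context: $T>0$; $M\ge 1$; $\mathbf{Y}_0\in\mathbb{R}^M$; $\mathbf{R}\in[L^2(0,T)]^M$; $\mathbb{D}+\mathbb{D}^T\le 0$ means negative semidefinite. $0=t_0<t_1<\cdots<t_N=T$ is a partition, $I_n=(t_n,t_{n+1})$, $\tau_n=t_{n+1}-t_n$, $\tau=\max_{0\le n\le N-1}\tau_n$. $P^m$ is the set of polynomials of degree at most $m$. $\mathbf{V}_\tau^m$ ($m\ge 1$) is the space of continuous functions $\mathbf{v}:[0,T]\to\mathbb{R}^M$ with $\mathbf{v}|_{I_n}\in[P^m]^M$ for all $0\le n\le N-1$. For $m\ge 0$, $\mathcal{P}_m$ is the local $L^2$ projection: on each $I_n$, $\mathcal{P}_m\mathbf{v}\in[P^m]^M$ and $\int_{I_n}(\mathcal{P}_m\mathbf{v},\mathbf{w})\,dt=\int_{I_n}(\mathbf{v},\mathbf{w})\,dt$ for all $\mathbf{w}\in[P^m]^M$. The discrete problem has a unique solution. The norm of a vector-valued function in $[X]^M$ is written $\|\cdot\|_X$; $\|\cdot\|_{\mathbb{R}^M}$ is the Euclidean norm. As usual, the generic constant $C$ does not depend on the data $\mathbf{Y}_0,\mathbf{R}$ or on the solution. *)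

theory Defs
  imports
    "HOL-Analysis.Analysis"
    "HOL-Computational_Algebra.Polynomial"
    "Jordan_Normal_Form.Matrix"
begin

text \<open>
  Vectors of \<open>\<real>\<^sup>M\<close> and \<open>M \<times> M\<close> matrices are those of Jordan Normal Form with carriers
  \<open>carrier_vec M\<close> and \<open>carrier_mat M M\<close>, so that the dimension \<open>M\<close> is an ordinary
  natural number and can be quantified inside a formula.
\<close>

unbundle no inner_syntax
unbundle no vec_syntax
hide_type (open) Finite_Cartesian_Product.vec
hide_const (open) Finite_Cartesian_Product.vec Finite_Cartesian_Product.vec_nth

definition eucl_norm :: "real vec \<Rightarrow> real" where
  "eucl_norm v = sqrt (v \<bullet> v)"

definition neg_semidef :: "nat \<Rightarrow> real mat \<Rightarrow> bool" where
  "neg_semidef M A \<longleftrightarrow>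
     A \<in> carrier_mat M M \<and> (\<forall>v \<in> carrier_vec M. v \<bullet> (A *\<^sub>v v) \<le> 0)"

definition is_partition :: "real \<Rightarrow> nat \<Rightarrow> (nat \<Rightarrow> real) \<Rightarrow> bool" where
  "is_partition T N t \<longleftrightarrow> t 0 = 0 \<and> t N = T \<and> (\<forall>n<N. t n < t (Suc n))"

abbreviation subinterval :: "(nat \<Rightarrow> real) \<Rightarrow> nat \<Rightarrow> real set" where
  "subinterval t n \<equiv> {t n <..< t (Suc n)}"

definition L2_space :: "nat \<Rightarrow> real \<Rightarrow> (real \<Rightarrow> real vec) set" where
  "L2_space M T = {v.
     (\<forall>s \<in> {0<..<T}. v s \<in> carrier_vec M) \<and>
     (\<forall>i<M. set_borel_measurable lebesgue {0<..<T} (\<lambda>s. v s $ i) \<and>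
            set_integrable lebesgue {0<..<T} (\<lambda>s. (v s $ i)\<^sup>2))}"

definition L2_norm :: "real \<Rightarrow> (real \<Rightarrow> real vec) \<Rightarrow> real" where
  "L2_norm T v = sqrt (LINT s:{0<..<T}|lebesgue. (eucl_norm (v s))\<^sup>2)"

text \<open>\<open>poly_on M m S\<close>: functions whose restriction to \<open>S\<close> lies in \<open>[P\<^sup>m]\<^sup>M\<close>; their values
  outside \<open>S\<close> are irrelevant.\<close>

definition poly_on :: "nat \<Rightarrow> nat \<Rightarrow> real set \<Rightarrow> (real \<Rightarrow> real vec) set" where
  "poly_on M m S = {v.
     (\<forall>s \<in> S. v s \<in> carrier_vec M) \<and>
     (\<forall>i<M. \<exists>p. degree p \<le> m \<and> (\<forall>s \<in> S. v s $ i = poly p s))}"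

definition V_space :: "nat \<Rightarrow> real \<Rightarrow> nat \<Rightarrow> (nat \<Rightarrow> real) \<Rightarrow> nat \<Rightarrow> (real \<Rightarrow> real vec) set" where
  "V_space M T N t m = {v.
     (\<forall>s \<in> {0..T}. v s \<in> carrier_vec M) \<and>
     (\<forall>i<M. continuous_on {0..T} (\<lambda>s. v s $ i)) \<and>
     (\<forall>n<N. v \<in> poly_on M m (subinterval t n))}"

definition is_L2_projection ::
    "nat \<Rightarrow> nat \<Rightarrow> (nat \<Rightarrow> real) \<Rightarrow> nat \<Rightarrow> (real \<Rightarrow> real vec) \<Rightarrow> (real \<Rightarrow> real vec) \<Rightarrow> bool" where
  "is_L2_projection M N t m v u \<longleftrightarrow>
     (\<forall>n<N. u \<in> poly_on M m (subinterval t n) \<and>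
        (\<forall>w \<in> poly_on M m (subinterval t n).
           (LINT s:subinterval t n|lebesgue. u s \<bullet> w s) =
           (LINT s:subinterval t n|lebesgue. v s \<bullet> w s)))"

text \<open>For \<open>v\<close> in \<open>L2_space M T\<close> the local \<open>L\<^sup>2\<close> projection exists and is determined on every
  open subinterval; \<open>SOME\<close> only makes a choice at the remaining points (the nodes of the
  partition and the points outside \<open>[0,T]\<close>), where the projection is never evaluated.\<close>

definition L2_proj ::
    "nat \<Rightarrow> nat \<Rightarrow> (nat \<Rightarrow> real) \<Rightarrow> nat \<Rightarrow> (real \<Rightarrow> real vec) \<Rightarrow> real \<Rightarrow> real vec" where
  "L2_proj M N t m v = (SOME u. is_L2_projection M N t m v u)"

definition ctg_solution ::
    "nat \<Rightarrow> real \<Rightarrow> nat \<Rightarrow> (nat \<Rightarrow> real) \<Rightarrow> nat \<Rightarrow> real mat \<Rightarrow> real vec \<Rightarrow> (real \<Rightarrow> real vec) \<Rightarrow>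
     (real \<Rightarrow> real vec) \<Rightarrow> bool" where
  "ctg_solution M T N t r D Y0 R Y \<longleftrightarrow>
     Y \<in> V_space M T N t r \<and> Y 0 = Y0 \<and>
     (\<forall>n<N. \<forall>s \<in> subinterval t n. \<forall>i<M.
        ((\<lambda>x. Y x $ i) has_real_derivative
           (D *\<^sub>v L2_proj M N t (r - 1) Y s + L2_proj M N t (r - 1) R s) $ i) (at s))"

end

theory Submission
  imports Defs
begin

text \<open>
  On one interval, with \<open>U = P\<^sub>r\<^sub>-\<^sub>1 Y\<close>, \<open>G = P\<^sub>r\<^sub>-\<^sub>1 R\<close> and an affine weight \<open>\<phi> = c - k s \<ge> 0\<close>,
  integrate \<open>(\<phi> |Y|\<^sup>2)' = - k |Y|\<^sup>2 + 2 \<phi> (Y', Y)\<close>. In \<open>(Y', Y) = (Y', U) + (Y', Y - U)\<close> the first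
  summand is at most \<open>(G, U)\<close> by dissipativity of \<open>D\<close>. For the second, \<open>\<phi> Y' + k r Y\<close> has degree
  less than \<open>r\<close>, hence is orthogonal to \<open>Y - U\<close>, so that \<open>\<phi> (Y', Y - U)\<close> integrates to
  \<open>- k r \<parallel>Y - U\<parallel>\<^sup>2 \<le> 0\<close>. The weight \<open>T - s\<close> gives the \<open>L\<^sup>2\<close> bound, with the sharp constant in
  front of \<open>Y\<^sub>0\<close>; the weight \<open>1\<close> bounds \<open>Y\<close> at the nodes; and the weight \<open>t\<^sub>n\<^sub>+\<^sub>1 - s\<close> bounds the \<open>L\<^sup>2\<close>
  norm on a single interval. The maximum norm then follows from the inverse inequality
  \<open>(b - a) p(s)\<^sup>2 \<le> (r + 1)\<^sup>2 \<parallel>p\<parallel>\<^sup>2\<close> on \<open>[a, b]\<close>. For \<open>s\<close> an endpoint it is proved by induction on \<open>r\<close>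
  with the same integration by parts; for interior \<open>s\<close>, add the endpoint bounds on \<open>[a, s]\<close> and
  \<open>[s, b]\<close>.
\<close>

hide_const (open) Module.smult

subsection \<open>Integrals of polynomials\<close>

text \<open>The Lebesgue integral over the open interval is the one used by the norm and the
  projection; taking a \<open>poly\<close> as argument makes linearity, products and
  \<open>pderiv\<close> available as polynomial algebra.\<close>

definition poly_integral :: "real \<Rightarrow> real \<Rightarrow> real poly \<Rightarrow> real" where
  "poly_integral a b p = (LINT s:{a<..<b}|lebesgue. poly p s)"

lemma set_integrable_poly: "set_integrable lebesgue {a<..<b} (poly (p :: real poly))"
proof -
  have "poly p absolutely_integrable_on {a..b}"
    by (intro absolutely_integrable_continuous_real continuous_intros)
  then show ?thesis
    by (rule set_integrable_subset) auto
qed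

lemma poly_integral_add: "poly_integral a b (p + q) = poly_integral a b p + poly_integral a b q"
  unfolding poly_integral_def poly_add by (intro set_integral_add set_integrable_poly)

lemma poly_integral_diff: "poly_integral a b (p - q) = poly_integral a b p - poly_integral a b q"
  unfolding poly_integral_def poly_diff by (intro set_integral_diff set_integrable_poly)

lemma poly_integral_smult: "poly_integral a b (smult c p) = c * poly_integral a b p"
proof -
  have "poly (smult c p) = (\<lambda>s. c * poly p s)" by auto
  then show ?thesis by (simp add: poly_integral_def)
qed

lemma poly_integral_sum: "poly_integral a b (\<Sum>i\<in>A. p i) = (\<Sum>i\<in>A. poly_integral a b (p i))"
proof (induction A rule: infinite_finite_induct)
  case (insert x F)
  then show ?case by (simp add: poly_integral_add)
qed (simp_all add: poly_integral_def)

lemma poly_integral_mono: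
  assumes "\<And>s. s \<in> {a<..<b} \<Longrightarrow> poly p s \<le> poly q s"
  shows "poly_integral a b p \<le> poly_integral a b q"
  unfolding poly_integral_def using assms by (intro set_integral_mono set_integrable_poly) auto

lemma poly_integral_eq_integral: "poly_integral a b p = integral {a..b} (poly p)"
  unfolding poly_integral_def
  by (subst set_lebesgue_integral_eq_integral(2)[OF set_integrable_poly])
     (simp add: integral_open_interval_real)

lemma poly_integral_pderiv:
  assumes "a \<le> b"
  shows "poly_integral a b (pderiv p) = poly p b - poly p a"
  unfolding poly_integral_eq_integral
  by (intro integral_unique fundamental_theorem_of_calculus assms)
     (auto intro: has_field_derivative_at_within poly_DERIV
        simp flip: has_real_derivative_iff_has_vector_derivative)

lemma poly_integral_combine:
  assumes "a \<le> c" "c \<le> b"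
  shows "poly_integral a c p + poly_integral c b p = poly_integral a b p"
  unfolding poly_integral_eq_integral
  by (intro Henstock_Kurzweil_Integration.integral_combine assms
        integrable_continuous_interval continuous_intros)

lemma poly_integral_square_nonneg: "0 \<le> poly_integral a b (p * p)"
  using poly_integral_mono[of a b 0 "p * p"] by (simp add: poly_integral_def)

lemma poly_eq_on_open_interval:
  fixes p q :: "real poly"
  assumes "a < b" and eq: "\<And>s. s \<in> {a<..<b} \<Longrightarrow> poly p s = poly q s"
  shows "p = q"
proof (rule ccontr)
  assume "p \<noteq> q"
  then have "finite {s. poly (p - q) s = 0}"
    by (intro poly_roots_finite) simp
  moreover have "{a<..<b} \<subseteq> {s. poly (p - q) s = 0}"
    using eq by auto
  ultimately show False
    using infinite_Ioo[OF \<open>a < b\<close>] finite_subset by blast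
qed

lemma poly_integral_square_pos:
  assumes "a < b" "p \<noteq> 0"
  shows "0 < poly_integral a b (p * p)"
proof (rule ccontr)
  assume "\<not> ?thesis"
  then have "integral {a..b} (poly (p * p)) = 0"
    using poly_integral_square_nonneg[of a b p] poly_integral_eq_integral[of a b "p * p"] by simp
  then have "\<forall>s\<in>{a..b}. poly (p * p) s = 0"
    using integral_eq_0_iff[of a b "poly (p * p)"] assms(1)
    by (simp add: continuous_intros)
  then have "p = 0"
    by (intro poly_eq_on_open_interval[OF assms(1)]) auto
  with assms(2) show False by simp
qed

text \<open>Riesz representation on the polynomials of degree at most \<open>m\<close>, by
  Gram-Schmidt: each step adds one orthogonal direction \<open>L\<close>, a multiple of the Legendre
  polynomial of the interval. \<open>F\<close> is left general because it is used both for a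
  polynomial integrated against \<open>w\<close> and for a component of a square integrable
  function.\<close>

lemma poly_projection_exists:
  fixes F :: "real poly \<Rightarrow> real"
  assumes ab: "a < b"
    and add: "\<And>p q. F (p + q) = F p + F q" and smult: "\<And>c p. F (smult c p) = c * F p"
  shows "\<exists>u. degree u \<le> m \<and> (\<forall>w. degree w \<le> m \<longrightarrow> poly_integral a b (u * w) = F w)"
  using add smult
proof (induction m arbitrary: F)
  case 0
  have pos: "0 < poly_integral a b 1"
    using poly_integral_square_pos[OF ab, of 1] by simp
  have "poly_integral a b ([:F 1 / poly_integral a b 1:] * w) = F w" if "degree w \<le> 0" for w
  proof -
    from that have "degree w = 0" by simp
    then obtain c where "w = [:c:]" by (rule degree_eq_zeroE)
    then have w: "w = smult c 1" by simp
    show ?thesis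
      using pos by (simp only: w 0(2) poly_integral_smult mult_smult_right mult_1_right)
         (simp add: poly_integral_smult[of a b _ 1, simplified])
  qed
  then show ?case
    by (intro exI[of _ "[:F 1 / poly_integral a b 1:]"]) simp
next
  case (Suc m)
  define x :: "real poly" where "x = monom 1 (Suc m)"
  obtain q where q: "degree q \<le> m"
      "\<And>w. degree w \<le> m \<Longrightarrow> poly_integral a b (q * w) = poly_integral a b (x * w)"
    using Suc.IH[of "\<lambda>w. poly_integral a b (x * w)"]
    by (auto simp: algebra_simps poly_integral_add poly_integral_smult)
  obtain u where u: "degree u \<le> m" "\<And>w. degree w \<le> m \<Longrightarrow> poly_integral a b (u * w) = F w"
    using Suc.IH[of F] Suc.prems by blast
  define L where "L = x - q"
  have orth: "poly_integral a b (L * w) = 0" if "degree w \<le> m" for w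
    using q(2)[OF that] by (simp add: L_def left_diff_distrib poly_integral_diff)
  have coeff_L: "coeff L (Suc m) = 1"
    using q(1) by (simp add: L_def x_def coeff_eq_0)
  have deg_L: "degree L \<le> Suc m"
    unfolding L_def x_def using q(1) by (intro degree_diff_le degree_monom_le) auto
  have "L \<noteq> 0" using coeff_L by auto
  then have pos: "0 < poly_integral a b (L * L)"
    by (intro poly_integral_square_pos ab)
  \<comment> \<open>The value of \<open>c\<close> is forced by testing the representation with
    \<open>w = L\<close>.\<close>
  define c where "c = (F L - poly_integral a b (u * L)) / poly_integral a b (L * L)"
  have "poly_integral a b ((u + smult c L) * w) = F w" if w: "degree w \<le> Suc m" for w
  proof -
    define d where "d = coeff w (Suc m)"
    \<comment> \<open>\<open>L\<close> is monic of degree \<open>Suc m\<close>, so subtracting its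
      multiple removes the top coefficient of \<open>w\<close>; the remainder \<open>v\<close> is
      covered by \<open>u\<close> and is orthogonal to \<open>L\<close>.\<close>
    define v where "v = w - smult d L"
    have "degree v \<le> Suc m"
      unfolding v_def using w deg_L by (intro degree_diff_le) (auto intro: order_trans[OF degree_smult_le])
    moreover have "coeff v (Suc m) = 0"
      by (simp add: v_def d_def coeff_L)
    ultimately have v: "degree v \<le> m"
      by (metis coeff_0 degree_0 eq_zero_or_degree_less le_Suc_eq less_Suc_eq_le zero_le)
    have w_eq: "w = v + smult d L" by (simp add: v_def)
    have "poly_integral a b ((u + smult c L) * w) =
        poly_integral a b (u * v) + d * poly_integral a b (u * L) + c * poly_integral a b (L * v)
        + c * d * poly_integral a b (L * L)"
      by (simp add: w_eq algebra_simps poly_integral_add poly_integral_smult smult_add_right)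
    also have "\<dots> = F v + d * F L"
      using pos u(2)[OF v] orth[OF v] by (simp add: c_def field_simps)
    also have "\<dots> = F w"
      by (simp add: w_eq Suc.prems)
    finally show ?thesis .
  qed
  moreover have "degree (u + smult c L) \<le> Suc m"
    using u(1) deg_L by (intro degree_add_le) (auto intro: order_trans[OF degree_smult_le])
  ultimately show ?case by blast
qed

text \<open>Multiplication by \<open>c + k s\<close> restores the degree lost by differentiation,
  and the coefficient at \<open>Suc m\<close> becomes \<open>k * Suc m\<close> times that of
  \<open>y\<close>. The difference of the two polynomials therefore has degree at most
  \<open>m\<close> and is invisible to \<open>z\<close>.\<close>

lemma weighted_derivative_orthogonal:
  assumes y: "degree y \<le> Suc m"
    and orth: "\<And>w. degree w \<le> m \<Longrightarrow> poly_integral a b (w * z) = 0"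
  shows "poly_integral a b ([:c, k:] * pderiv y * z) = k * real (Suc m) * poly_integral a b (y * z)"
proof -
  define w where "w = [:c, k:] * pderiv y - smult (k * real (Suc m)) y"
  have "degree (pderiv y) \<le> m"
    using y by (simp add: degree_pderiv)
  then have "degree ([:c, k:] * pderiv y) \<le> Suc m"
    by (intro order_trans[OF degree_mult_le]) auto
  then have "degree w \<le> Suc m"
    unfolding w_def using y by (intro degree_diff_le) (auto intro: order_trans[OF degree_smult_le])
  moreover have "coeff w (Suc m) = 0"
    using y by (simp add: w_def coeff_pderiv coeff_eq_0)
  ultimately have "degree w \<le> m"
    by (metis coeff_0 degree_0 eq_zero_or_degree_less le_Suc_eq less_Suc_eq_le zero_le)
  from orth[OF this] show ?thesis
    by (simp add: w_def left_diff_distrib poly_integral_diff poly_integral_smult)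
qed

text \<open>Integration by parts: the derivative of \<open>(c + k s) y^2\<close> is integrated. Here
  \<open>k\<close> is the slope of the weight.\<close>

lemma poly_integral_weighted_square:
  assumes "a \<le> b"
  shows "poly [:c, k:] b * (poly y b)\<^sup>2 - poly [:c, k:] a * (poly y a)\<^sup>2 =
    k * poly_integral a b (y * y) + 2 * poly_integral a b ([:c, k:] * pderiv y * y)"
proof -
  have "pderiv ([:c, k:] * (y * y)) = smult k (y * y) + smult 2 ([:c, k:] * pderiv y * y)"
    unfolding pderiv_mult[of "[:c, k:]"] pderiv_mult[of y y]
    by (intro poly_eq_poly_eq_iff[THEN iffD1] ext) (simp add: pderiv_pCons algebra_simps)
  then show ?thesis
    using poly_integral_pderiv[OF assms, of "[:c, k:] * (y * y)"]
    by (simp add: poly_integral_add poly_integral_smult power2_eq_square algebra_simps)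
qed

subsection \<open>Inverse inequality\<close>

lemma poly_integral_orthogonal_endpoint:
  assumes "a \<le> b" "degree L \<le> Suc m"
    and orth: "\<And>w. degree w \<le> m \<Longrightarrow> poly_integral a b (w * L) = 0"
    and "c = a \<or> c = b"
  shows "(b - a) * (poly L c)\<^sup>2 = (2 * real m + 3) * poly_integral a b (L * L)"
proof -
  have "poly_integral a b ([:d, 1:] * pderiv L * L) = 1 * real (Suc m) * poly_integral a b (L * L)" for d
    by (rule weighted_derivative_orthogonal[OF assms(2) orth])
  then have "poly [:d, 1:] b * (poly L b)\<^sup>2 - poly [:d, 1:] a * (poly L a)\<^sup>2 =
      (2 * real m + 3) * poly_integral a b (L * L)" for d
    by (simp only: poly_integral_weighted_square[OF assms(1)]) (simp add: algebra_simps)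
  \<comment> \<open>The weights \<open>s - a\<close> and \<open>s - b\<close> each vanish at one
    endpoint, so each isolates the value of \<open>L\<close> at the other one.\<close>
  from this[of "- a"] this[of "- b"] show ?thesis
    using assms(4) by (auto simp: algebra_simps)
qed

text \<open>Splitting off the part \<open>L\<close> orthogonal to lower degree is Pythagorean in the
  integral, while \<open>L\<close> alone obeys the endpoint identity with factor
  \<open>2 m + 3\<close>. The factors accumulate as 1 + 3 + 5 + ..., which is where the square of
  the degree plus one comes from.\<close>

lemma poly_endpoint_bound:
  assumes ab: "a < b" and c: "c = a \<or> c = b"
  shows "degree p \<le> m \<Longrightarrow> (b - a) * (poly p c)\<^sup>2 \<le> (real m + 1)\<^sup>2 * poly_integral a b (p * p)"
proof (induction m arbitrary: p)
  case 0
  then have "degree p = 0" by simp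
  then obtain d where p: "p = [:d:]" by (rule degree_eq_zeroE)
  have "poly_integral a b (p * p) = d\<^sup>2 * (b - a)"
    using ab poly_integral_pderiv[of a b "[:0, d * d:]"]
    by (simp add: p pderiv_pCons power2_eq_square algebra_simps)
  then show ?case by (simp add: p)
next
  case (Suc m)
  obtain q where q: "degree q \<le> m"
      "\<And>w. degree w \<le> m \<Longrightarrow> poly_integral a b (q * w) = poly_integral a b (p * w)"
    using poly_projection_exists[OF ab, of "\<lambda>w. poly_integral a b (p * w)" m]
    by (auto simp: algebra_simps poly_integral_add poly_integral_smult)
  define L where "L = p - q"
  have orth: "poly_integral a b (w * L) = 0" if "degree w \<le> m" for w
    using q(2)[OF that] by (simp add: L_def algebra_simps poly_integral_diff)
  have deg_L: "degree L \<le> Suc m"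
    unfolding L_def using q(1) Suc.prems by (intro degree_diff_le) auto
  have p: "p = q + L" by (simp add: L_def)
  define Q where "Q = poly_integral a b (q * q)"
  define E where "E = poly_integral a b (L * L)"
  have QE: "0 \<le> Q" "0 \<le> E"
    by (simp_all add: Q_def E_def poly_integral_square_nonneg)
  have "p * p = q * q + smult 2 (q * L) + L * L"
    by (intro poly_eq_poly_eq_iff[THEN iffD1] ext) (simp add: p algebra_simps)
  then have pythagoras: "poly_integral a b (p * p) = Q + E"
    by (simp add: poly_integral_add poly_integral_smult orth[OF q(1)] Q_def E_def)
  define h where "h = b - a"
  have h: "0 < h" using ab by (simp add: h_def)
  define x where "x = poly q c"
  define y where "y = poly L c"
  define n where "n = real m + 1"
  have n: "0 < n" by (simp add: n_def)
  have x: "h * x\<^sup>2 \<le> n\<^sup>2 * Q"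
    using Suc.IH[OF q(1)] by (simp add: h_def x_def n_def Q_def)
  have y: "h * y\<^sup>2 = (2 * n + 1) * E"
    using poly_integral_orthogonal_endpoint[OF less_imp_le[OF ab] deg_L orth c]
    by (simp add: h_def y_def n_def E_def algebra_simps)
  \<comment> \<open>Cauchy--Schwarz for the sum of two terms with weights \<open>n\<^sup>2\<close> and \<open>2n + 1\<close>, whose total is \<open>(n + 1)\<^sup>2\<close>\<close>
  have young: "n\<^sup>2 * (2 * n + 1) * (x + y)\<^sup>2 \<le> (n + 1)\<^sup>2 * ((2 * n + 1) * x\<^sup>2 + n\<^sup>2 * y\<^sup>2)"
  proof -
    have "(n + 1)\<^sup>2 * ((2 * n + 1) * x\<^sup>2 + n\<^sup>2 * y\<^sup>2) - n\<^sup>2 * (2 * n + 1) * (x + y)\<^sup>2 =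
        ((2 * n + 1) * x - n\<^sup>2 * y)\<^sup>2"
      by (simp add: power2_eq_square algebra_simps)
    then show ?thesis using zero_le_power2[of "(2 * n + 1) * x - n\<^sup>2 * y"] by linarith
  qed
  have "n\<^sup>2 * (2 * n + 1) * (h * (x + y)\<^sup>2) = h * (n\<^sup>2 * (2 * n + 1) * (x + y)\<^sup>2)"
    by simp
  also have "\<dots> \<le> h * ((n + 1)\<^sup>2 * ((2 * n + 1) * x\<^sup>2 + n\<^sup>2 * y\<^sup>2))"
    using young h by (intro mult_left_mono) auto
  also have "\<dots> = (n + 1)\<^sup>2 * ((2 * n + 1) * (h * x\<^sup>2) + n\<^sup>2 * (h * y\<^sup>2))"
    by (simp add: power2_eq_square algebra_simps)
  also have "\<dots> \<le> (n + 1)\<^sup>2 * ((2 * n + 1) * (n\<^sup>2 * Q) + n\<^sup>2 * ((2 * n + 1) * E))"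
    using x n unfolding y by (intro mult_left_mono add_mono order_refl) auto
  also have "\<dots> = n\<^sup>2 * (2 * n + 1) * ((n + 1)\<^sup>2 * (Q + E))"
    by (simp add: power2_eq_square algebra_simps)
  finally have "h * (x + y)\<^sup>2 \<le> (n + 1)\<^sup>2 * (Q + E)"
    using n by (subst (asm) mult_le_cancel_left_pos) auto
  then show ?case
    unfolding pythagoras by (simp add: h_def x_def y_def n_def p add_ac)
qed

lemma poly_inverse_inequality:
  assumes ab: "a < b" and c: "c \<in> {a..b}" and p: "degree p \<le> m"
  shows "(b - a) * (poly p c)\<^sup>2 \<le> (real m + 1)\<^sup>2 * poly_integral a b (p * p)"
proof (cases "a < c \<and> c < b")
  case True
  have "(b - a) * (poly p c)\<^sup>2 = (c - a) * (poly p c)\<^sup>2 + (b - c) * (poly p c)\<^sup>2"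
    by (simp add: algebra_simps)
  also have "\<dots> \<le> (real m + 1)\<^sup>2 * poly_integral a c (p * p) + (real m + 1)\<^sup>2 * poly_integral c b (p * p)"
    using True p by (intro add_mono poly_endpoint_bound) auto
  also have "\<dots> = (real m + 1)\<^sup>2 * poly_integral a b (p * p)"
    using c by (simp flip: distrib_left add: poly_integral_combine)
  finally show ?thesis .
next
  case False
  then show ?thesis
    using assms by (intro poly_endpoint_bound) auto
qed

subsection \<open>Weighted energy estimate on one interval\<close>

text \<open>The derivative is tested with the projection \<open>u\<close> instead of
  \<open>y\<close>, because dissipativity controls only the product of \<open>D u\<close> with
  \<open>u\<close>. The price is the projection defect \<open>y - u\<close>, whose coefficient has
  the sign of the slope \<open>k\<close>.\<close>

lemma energy_identity:
  assumes ab: "a \<le> b" and deg: "degree y \<le> Suc m" "degree u \<le> m"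
    and orth: "\<And>w. degree w \<le> m \<Longrightarrow> poly_integral a b (w * (y - u)) = 0"
  shows "poly [:c, k:] b * (poly y b)\<^sup>2 - poly [:c, k:] a * (poly y a)\<^sup>2 - k * poly_integral a b (y * y) =
    2 * poly_integral a b ([:c, k:] * pderiv y * u)
    + 2 * k * real (Suc m) * poly_integral a b ((y - u) * (y - u))"
proof -
  have "poly_integral a b (y * (y - u)) =
      poly_integral a b (u * (y - u)) + poly_integral a b ((y - u) * (y - u))"
    by (simp add: algebra_simps flip: poly_integral_add)
  \<comment> \<open>Orthogonality of the defect to \<open>u\<close> itself turns its product with
    \<open>y\<close> into its square.\<close>
  then have eq: "poly_integral a b (y * (y - u)) = poly_integral a b ((y - u) * (y - u))"
    using orth[OF deg(2)] by simp
  have "poly_integral a b ([:c, k:] * pderiv y * y) =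
      poly_integral a b ([:c, k:] * pderiv y * u) + poly_integral a b ([:c, k:] * pderiv y * (y - u))"
    by (simp add: right_diff_distrib flip: poly_integral_add del: mult_pCons_left)
  also have "poly_integral a b ([:c, k:] * pderiv y * (y - u)) =
      k * real (Suc m) * poly_integral a b ((y - u) * (y - u))"
    by (simp only: weighted_derivative_orthogonal[OF deg(1) orth] eq)
  finally show ?thesis
    unfolding poly_integral_weighted_square[OF ab] by (simp add: algebra_simps del: mult_pCons_left)
qed

text \<open>The slope is now \<open>- k\<close>, so weights decrease and the projection defect has
  the favourable sign. Young's parameter \<open>\<epsilon>\<close> stays free: the estimates remain
  additive over the intervals and \<open>\<epsilon>\<close> is optimised only after
  summation.\<close>

lemma local_energy_estimate:
  fixes y u g :: "nat \<Rightarrow> real poly" and A :: "nat \<Rightarrow> nat \<Rightarrow> real"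
  assumes ab: "a < b" and eps: "0 < \<epsilon>"
    and deg: "\<And>i. i < M \<Longrightarrow> degree (y i) \<le> Suc m" "\<And>i. i < M \<Longrightarrow> degree (u i) \<le> m"
    and orth: "\<And>i w. i < M \<Longrightarrow> degree w \<le> m \<Longrightarrow> poly_integral a b (u i * w) = poly_integral a b (y i * w)"
    and ode: "\<And>i. i < M \<Longrightarrow> pderiv (y i) = (\<Sum>j<M. smult (A i j) (u j)) + g i"
    and nonpos: "\<And>x. (\<Sum>i<M. x i * (\<Sum>j<M. A i j * x j)) \<le> 0"
    and k: "0 \<le> k" and weight: "\<And>s. s \<in> {a<..<b} \<Longrightarrow> 0 \<le> c - k * s \<and> c - k * s \<le> \<Phi>"
  shows "(c - k * b) * (\<Sum>i<M. (poly (y i) b)\<^sup>2) - (c - k * a) * (\<Sum>i<M. (poly (y i) a)\<^sup>2)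
      + k * (\<Sum>i<M. poly_integral a b (y i * y i))
    \<le> \<Phi> * (\<epsilon> * (\<Sum>i<M. poly_integral a b (g i * g i)) + (\<Sum>i<M. poly_integral a b (y i * y i)) / \<epsilon>)"
proof -
  have orth': "poly_integral a b (w * (y i - u i)) = 0" if "i < M" "degree w \<le> m" for i w
    using orth[OF that] by (simp add: algebra_simps poly_integral_diff)
  have "0 \<le> \<Phi>"
    using weight[of "(a + b) / 2"] ab by force
  \<comment> \<open>Pythagoras: the projection does not increase the norm, so \<open>u\<close> can
    be traded for \<open>y\<close> at the end.\<close>
  have u_le: "poly_integral a b (u i * u i) \<le> poly_integral a b (y i * y i)" if i: "i < M" for i
  proof -
    have "0 \<le> poly_integral a b ((y i - u i) * (y i - u i))"
      by (rule poly_integral_square_nonneg)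
    also have "\<dots> = poly_integral a b (y i * (y i - u i))"
      using orth'[OF i deg(2)[OF i]] by (simp add: left_diff_distrib poly_integral_diff)
    also have "\<dots> = poly_integral a b (y i * y i) - poly_integral a b (u i * u i)"
      using orth[OF i deg(2)[OF i]] by (simp add: right_diff_distrib poly_integral_diff)
    finally show ?thesis by simp
  qed
  have "(c - k * b) * (\<Sum>i<M. (poly (y i) b)\<^sup>2) - (c - k * a) * (\<Sum>i<M. (poly (y i) a)\<^sup>2)
      + k * (\<Sum>i<M. poly_integral a b (y i * y i)) =
    (\<Sum>i<M. poly [:c, - k:] b * (poly (y i) b)\<^sup>2 - poly [:c, - k:] a * (poly (y i) a)\<^sup>2
        - (- k) * poly_integral a b (y i * y i))"
    by (simp add: sum.distrib sum_subtractf sum_distrib_left algebra_simps)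
  also have "\<dots> = (\<Sum>i<M. 2 * poly_integral a b ([:c, - k:] * pderiv (y i) * u i)
      + 2 * (- k) * real (Suc m) * poly_integral a b ((y i - u i) * (y i - u i)))"
    using ab deg orth' by (intro sum.cong refl energy_identity) auto
  \<comment> \<open>The defect term carries the factor \<open>- k\<close> times a square integral
    and is dropped.\<close>
  also have "\<dots> \<le> (\<Sum>i<M. 2 * poly_integral a b ([:c, - k:] * pderiv (y i) * u i))"
    using k by (intro sum_mono) (simp add: poly_integral_square_nonneg del: mult_pCons_left)
  also have "\<dots> = poly_integral a b (\<Sum>i<M. smult 2 ([:c, - k:] * pderiv (y i) * u i))"
    by (simp add: poly_integral_sum poly_integral_smult del: mult_pCons_left)
  also have "\<dots> \<le> poly_integral a b (smult \<Phi> (\<Sum>i<M. smult \<epsilon> (g i * g i) + smult (1 / \<epsilon>) (u i * u i)))"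
  proof (rule poly_integral_mono)
    fix s assume s: "s \<in> {a<..<b}"
    let ?w = "c - k * s" and ?u = "\<lambda>i. poly (u i) s" and ?g = "\<lambda>i. poly (g i) s"
    have "poly (\<Sum>i<M. smult 2 ([:c, - k:] * pderiv (y i) * u i)) s =
        (\<Sum>i<M. 2 * (?w * ((\<Sum>j<M. A i j * ?u j) + ?g i) * ?u i))"
      unfolding poly_sum by (intro sum.cong refl) (simp add: ode poly_sum algebra_simps)
    also have "\<dots> = 2 * ?w * (\<Sum>i<M. ?u i * (\<Sum>j<M. A i j * ?u j)) + ?w * (\<Sum>i<M. 2 * ?g i * ?u i)"
      unfolding sum_distrib_left[of "2 * ?w"] sum_distrib_left[of ?w] sum.distrib[symmetric]
      by (intro sum.cong refl) (simp add: algebra_simps)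
    \<comment> \<open>The quadratic form of \<open>A\<close> is nonpositive and the weight
      nonnegative; Young's inequality handles the source term.\<close>
    also have "\<dots> \<le> 0 + ?w * (\<Sum>i<M. \<epsilon> * (?g i * ?g i) + 1 / \<epsilon> * (?u i * ?u i))"
    proof (intro add_mono mult_left_mono sum_mono)
      fix i
      have "\<epsilon> * (?g i * ?g i) + 1 / \<epsilon> * (?u i * ?u i) - 2 * ?g i * ?u i = (\<epsilon> * ?g i - ?u i)\<^sup>2 / \<epsilon>"
        using eps by (simp add: power2_eq_square field_simps)
      also have "\<dots> \<ge> 0" using eps by simp
      finally show "2 * ?g i * ?u i \<le> \<epsilon> * (?g i * ?g i) + 1 / \<epsilon> * (?u i * ?u i)" by simp
    qed (use weight[OF s] nonpos in \<open>auto intro: mult_nonneg_nonpos\<close>)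
    also have "\<dots> \<le> \<Phi> * (\<Sum>i<M. \<epsilon> * (?g i * ?g i) + 1 / \<epsilon> * (?u i * ?u i))"
      using weight[OF s] eps by (auto intro!: mult_right_mono sum_nonneg)
    finally show "poly (\<Sum>i<M. smult 2 ([:c, - k:] * pderiv (y i) * u i)) s \<le>
        poly (smult \<Phi> (\<Sum>i<M. smult \<epsilon> (g i * g i) + smult (1 / \<epsilon>) (u i * u i))) s"
      by (simp add: poly_sum)
  qed
  also have "\<dots> = \<Phi> * (\<epsilon> * (\<Sum>i<M. poly_integral a b (g i * g i))
      + (\<Sum>i<M. poly_integral a b (u i * u i)) / \<epsilon>)"
    by (simp add: poly_integral_sum poly_integral_smult poly_integral_add sum.distrib
        sum_distrib_left sum_divide_distrib)
  also have "\<dots> \<le> \<Phi> * (\<epsilon> * (\<Sum>i<M. poly_integral a b (g i * g i))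
      + (\<Sum>i<M. poly_integral a b (y i * y i)) / \<epsilon>)"
    using \<open>0 \<le> \<Phi>\<close> eps u_le by (intro mult_left_mono add_left_mono divide_right_mono sum_mono) auto
  finally show ?thesis .
qed

text \<open>The infimum over \<epsilon> of the right-hand side is \<open>2 * p * q\<close>, formally
  reached at \<open>q / p\<close>. It need not be attained when \<open>p\<close> or \<open>q\<close>
  vanishes, hence the passage through an arbitrary error \<open>e\<close>.\<close>

lemma le_twice_mult_if_young:
  fixes z p q :: real
  assumes "0 \<le> p" "0 \<le> q" and young: "\<And>\<epsilon>. 0 < \<epsilon> \<Longrightarrow> z \<le> \<epsilon> * p\<^sup>2 + q\<^sup>2 / \<epsilon>"
  shows "z \<le> 2 * p * q"
proof (rule field_le_epsilon)
  fix e :: real assume "0 < e"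
  \<comment> \<open>This size makes the total error \<open>\<delta> * (p + q)\<close> at most
    \<open>e\<close>; the added 1 keeps the denominator positive.\<close>
  define \<delta> where "\<delta> = e / (p + q + 1)"
  have \<delta>: "0 < \<delta>" using \<open>0 < e\<close> assms by (simp add: \<delta>_def)
  \<comment> \<open>Both terms of the ideal quotient \<open>q / p\<close> are shifted by
    \<open>\<delta>\<close>, so it is positive and well defined.\<close>
  have "z \<le> (q + \<delta>) / (p + \<delta>) * p\<^sup>2 + q\<^sup>2 / ((q + \<delta>) / (p + \<delta>))"
    using assms \<delta> by (intro young) auto
  also have "\<dots> = (q + \<delta>) * p * (p / (p + \<delta>)) + q * (p + \<delta>) * (q / (q + \<delta>))"
    by (simp add: power2_eq_square field_simps)
  also have "\<dots> \<le> (q + \<delta>) * p * 1 + q * (p + \<delta>) * 1"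
    using assms \<delta> by (intro add_mono mult_left_mono) auto
  also have "\<dots> = 2 * p * q + \<delta> * (p + q)"
    by (simp add: algebra_simps)
  also have "\<dots> \<le> 2 * p * q + e"
    using \<open>0 < e\<close> assms by (simp add: \<delta>_def divide_simps algebra_simps)
  finally show "z \<le> 2 * p * q + e" .
qed

text \<open>Otherwise \<open>x - d\<close> exceeds \<open>q\<close>, and so does \<open>x\<close>,
  contradicting the bound on \<open>x * (x - d)\<close>. Keeping the factor 1 in front of
  \<open>q\<close> is what preserves the sharp constant for the initial value.\<close>

lemma le_add_if_square_le:
  fixes x q d :: real
  assumes "0 \<le> q" "0 \<le> d" and le: "x\<^sup>2 \<le> q\<^sup>2 + d * x"
  shows "x \<le> q + d"
proof (rule ccontr)
  assume "\<not> x \<le> q + d"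
  then have "q * q < x * (x - d)"
    using assms(1,2) by (intro mult_strict_mono') auto
  with le show False by (simp add: power2_eq_square algebra_simps)
qed

subsection \<open>Partitions\<close>

lemma partition_mono:
  assumes "is_partition T N t" "i \<le> j" "j \<le> N"
  shows "t i \<le> t j"
  using assms(2,3)
proof (induction j rule: dec_induct)
  case (step n)
  then have "t n < t (Suc n)"
    using assms(1) by (simp add: is_partition_def)
  with step show ?case by simp
qed simp

lemma partition_range:
  assumes "is_partition T N t" "n < N"
  shows "0 \<le> t n" "t n < t (Suc n)" "t (Suc n) \<le> T"
  using assms partition_mono[OF assms(1), of 0 n] partition_mono[OF assms(1), of "Suc n" N]
  by (auto simp: is_partition_def)

lemma partition_disjoint:
  assumes "is_partition T N t" "n < N" "m < N" "s \<in> subinterval t n" "s \<in> subinterval t m"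
  shows "n = m"
proof (rule ccontr)
  assume "n \<noteq> m"
  then consider "Suc n \<le> m" | "Suc m \<le> n" by linarith
  then show False
    using partition_mono[OF assms(1), of "Suc n" m] partition_mono[OF assms(1), of "Suc m" n] assms
    by cases auto
qed

lemma partition_cover:
  assumes "is_partition T N t" "0 < T" "s \<in> {0..T}"
  obtains n where "n < N" "s \<in> {t n..t (Suc n)}"
proof -
  have "\<exists>n<k. s \<in> {t n..t (Suc n)}" if "k \<le> N" "0 < k" "s \<le> t k" for k
    using that
  proof (induction k)
    case (Suc k)
    show ?case
    proof (cases "0 < k \<and> s \<le> t k")
      case True
      with Suc obtain n where "n < k" "s \<in> {t n..t (Suc n)}" by auto
      then show ?thesis by (intro exI[of _ n]) auto
    next
      case False
      then have "t k \<le> s"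
        using assms(1,3) by (cases "k = 0") (auto simp: is_partition_def)
      with Suc.prems show ?thesis by (intro exI[of _ k]) auto
    qed
  qed simp
  moreover have "0 < N"
    using assms(1,2) by (cases N) (auto simp: is_partition_def)
  moreover have "s \<le> t N"
    using assms(1,3) by (simp add: is_partition_def)
  ultimately show ?thesis using that by blast
qed

text \<open>The detour through the gauge integral over closed intervals lets neighbouring pieces be
  joined without treating the nodes as null sets.\<close>

lemma partition_integral:
  fixes f :: "real \<Rightarrow> real"
  assumes part: "is_partition T N t" and f: "set_integrable lebesgue {0<..<T} f"
  shows "(LINT s:{0<..<T}|lebesgue. f s) = (\<Sum>n<N. LINT s:subinterval t n|lebesgue. f s)"
proof -
  have int: "f integrable_on {0..T}"
    using set_lebesgue_integral_eq_integral(1)[OF f] by (simp add: integrable_on_open_interval_real)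
  have "integral {0..t m} f = (\<Sum>n<m. integral {t n..t (Suc n)} f)" if "m \<le> N" for m
    using that
  proof (induction m)
    case 0
    then show ?case using part by (simp add: is_partition_def)
  next
    case (Suc m)
    have "integral {0..t m} f + integral {t m..t (Suc m)} f = integral {0..t (Suc m)} f"
      using partition_range[OF part, of m] Suc.prems
      by (intro Henstock_Kurzweil_Integration.integral_combine integrable_on_subinterval[OF int]) auto
    with Suc show ?case by simp
  qed
  from this[of N] have "integral {0..T} f = (\<Sum>n<N. integral {t n..t (Suc n)} f)"
    using part by (simp add: is_partition_def)
  moreover have "(LINT s:subinterval t n|lebesgue. f s) = integral {t n..t (Suc n)} f" if "n < N" for n
  proof -
    have "set_integrable lebesgue (subinterval t n) f"
      using partition_range[OF part that] by (intro set_integrable_subset[OF f]) auto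
    then show ?thesis
      by (simp add: set_lebesgue_integral_eq_integral integral_open_interval_real)
  qed
  moreover have "(LINT s:{0<..<T}|lebesgue. f s) = integral {0..T} f"
    using f by (simp add: set_lebesgue_integral_eq_integral integral_open_interval_real)
  ultimately show ?thesis by simp
qed

subsection \<open>Square integrable functions and the local projection\<close>

text \<open>One component of \<open>L2_space\<close>, on an arbitrary interval so that it can be
  restricted to a subinterval. Measurability is a separate clause since that of the square does not
  imply that of \<open>f\<close>.\<close>

definition square_integrable :: "real \<Rightarrow> real \<Rightarrow> (real \<Rightarrow> real) \<Rightarrow> bool" where
  "square_integrable a b f \<longleftrightarrow> set_borel_measurable lebesgue {a<..<b} f \<and>
     set_integrable lebesgue {a<..<b} (\<lambda>s. (f s)\<^sup>2)"

lemma L2_space_iff: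
  "v \<in> L2_space M T \<longleftrightarrow> (\<forall>s\<in>{0<..<T}. v s \<in> carrier_vec M) \<and>
     (\<forall>i<M. square_integrable 0 T (\<lambda>s. v s $ i))"
  by (auto simp: L2_space_def square_integrable_def)

lemma square_integrable_subset:
  assumes "square_integrable a b f" "a \<le> c" "d \<le> b"
  shows "square_integrable c d f"
  using assms unfolding square_integrable_def
  by (auto intro!: set_borel_measurable_subset[of lebesgue "{a<..<b}" f]
        set_integrable_subset[of lebesgue "{a<..<b}" "\<lambda>s. (f s)\<^sup>2"])

lemma square_integrable_continuous:
  assumes "continuous_on {a..b} f"
  shows "square_integrable a b f"
proof -
  have *: "set_integrable lebesgue {a<..<b} g" if "continuous_on {a..b} g" for g :: "real \<Rightarrow> real"
    using that by (intro set_integrable_subset[OF absolutely_integrable_continuous_real]) auto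
  have "set_borel_measurable lebesgue {a<..<b} f"
    using *[OF assms] by (simp add: set_integrable_def set_borel_measurable_def borel_measurable_integrable)
  then show ?thesis
    unfolding square_integrable_def using assms by (auto intro!: * continuous_intros)
qed

text \<open>The product is dominated by \<open>f^2 + g^2\<close>.\<close>

lemma square_integrable_mult:
  assumes f: "square_integrable a b f" and g: "square_integrable a b g"
  shows "set_integrable lebesgue {a<..<b} (\<lambda>s. f s * g s)"
proof (rule set_integrable_bound)
  show "set_integrable lebesgue {a<..<b} (\<lambda>s. (f s)\<^sup>2 + (g s)\<^sup>2)"
    using f g unfolding square_integrable_def by (intro set_integral_add) auto
  \<comment> \<open>Measurability on a set concerns the function times the indicator; the indicator
    is idempotent, so the product of the cut-off functions is the cut-off product.\<close>
  have "(\<lambda>s. (indicat_real {a<..<b} s *\<^sub>R f s) * (indicat_real {a<..<b} s *\<^sub>R g s)) \<in> borel_measurable lebesgue"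
    using f g unfolding square_integrable_def set_borel_measurable_def
    by (intro borel_measurable_times) auto
  also have "(\<lambda>s. (indicat_real {a<..<b} s *\<^sub>R f s) * (indicat_real {a<..<b} s *\<^sub>R g s)) =
      (\<lambda>s. indicat_real {a<..<b} s *\<^sub>R (f s * g s))"
    by (auto simp: indicator_def)
  finally show "set_borel_measurable lebesgue {a<..<b} (\<lambda>s. f s * g s)"
    by (simp add: set_borel_measurable_def)
  have "\<bar>x * y\<bar> \<le> \<bar>x\<^sup>2 + y\<^sup>2\<bar>" for x y :: real
  proof -
    have "2 * (\<bar>x\<bar> * \<bar>y\<bar>) \<le> x\<^sup>2 + y\<^sup>2"
      using zero_le_power2[of "\<bar>x\<bar> - \<bar>y\<bar>"] by (simp add: power2_diff)
    moreover have "0 \<le> \<bar>x\<bar> * \<bar>y\<bar>" by simp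
    ultimately show ?thesis unfolding abs_mult by linarith
  qed
  then show "AE s in lebesgue. s \<in> {a<..<b} \<longrightarrow> norm (f s * g s) \<le> norm ((f s)\<^sup>2 + (g s)\<^sup>2)"
    by simp
qed

lemma square_integrable_poly: "square_integrable a b (poly p)"
  by (intro square_integrable_continuous continuous_intros)

text \<open>Bessel's inequality: \<open>2 f p - p^2 \<le> f^2\<close> is integrated, and the
  projection property with \<open>w = p\<close> replaces the mixed integral by that of
  \<open>p^2\<close>.\<close>

lemma poly_projection_le:
  assumes f: "square_integrable a b f" and deg: "degree p \<le> m"
    and proj: "\<And>w. degree w \<le> m \<Longrightarrow> poly_integral a b (p * w) = (LINT s:{a<..<b}|lebesgue. f s * poly w s)"
  shows "poly_integral a b (p * p) \<le> (LINT s:{a<..<b}|lebesgue. (f s)\<^sup>2)"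
proof -
  note int = square_integrable_mult[OF f square_integrable_poly] set_integrable_poly[of a b "p * p"]
    and f2 = f[unfolded square_integrable_def, THEN conjunct2]
  have "2 * poly_integral a b (p * p) - poly_integral a b (p * p) =
      (LINT s:{a<..<b}|lebesgue. 2 * (f s * poly p s)) - (LINT s:{a<..<b}|lebesgue. poly (p * p) s)"
    using proj[OF deg] by (simp add: poly_integral_def)
  also have "\<dots> = (LINT s:{a<..<b}|lebesgue. 2 * (f s * poly p s) - poly (p * p) s)"
    by (intro set_integral_diff(2)[symmetric] set_integrable_mult_right int)
  also have "\<dots> \<le> (LINT s:{a<..<b}|lebesgue. (f s)\<^sup>2)"
  proof (intro set_integral_mono set_integral_diff(1) set_integrable_mult_right int f2)
    fix s show "2 * (f s * poly p s) - poly (p * p) s \<le> (f s)\<^sup>2"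
      using zero_le_power2[of "f s - poly p s"] by (simp add: power2_eq_square algebra_simps)
  qed
  finally show ?thesis by simp
qed

text \<open>Reduces the vector-valued orthogonality to components. The scalar product runs over the
  dimension of its right factor, so the dimension is prescribed for \<open>w\<close>.\<close>

lemma integral_scalar_prod:
  assumes v: "\<And>i. i < M \<Longrightarrow> square_integrable a b (\<lambda>s. v s $ i)"
    and w: "\<And>s. s \<in> {a<..<b} \<Longrightarrow> w s \<in> carrier_vec M"
    and p: "\<And>i s. i < M \<Longrightarrow> s \<in> {a<..<b} \<Longrightarrow> w s $ i = poly (p i) s"
  shows "(LINT s:{a<..<b}|lebesgue. v s \<bullet> w s) = (\<Sum>i<M. LINT s:{a<..<b}|lebesgue. v s $ i * poly (p i) s)"
proof -
  have "(LINT s:{a<..<b}|lebesgue. v s \<bullet> w s) = (LINT s:{a<..<b}|lebesgue. \<Sum>i<M. v s $ i * poly (p i) s)"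
  proof (intro set_lebesgue_integral_cong allI impI)
    fix s assume s: "s \<in> {a<..<b}"
    then have "dim_vec (w s) = M" using w by (simp add: carrier_vecD)
    with s show "v s \<bullet> w s = (\<Sum>i<M. v s $ i * poly (p i) s)"
      by (simp add: scalar_prod_def lessThan_atLeast0 p)
  qed simp
  also have "\<dots> = (\<Sum>i<M. LINT s:{a<..<b}|lebesgue. v s $ i * poly (p i) s)"
    unfolding set_lebesgue_integral_def scaleR_sum_right
    using square_integrable_mult[OF v square_integrable_poly]
    by (intro Bochner_Integration.integral_sum) (auto simp: set_integrable_def)
  finally show ?thesis .
qed

text \<open>The \<open>SOME\<close> in \<open>L2_proj\<close> is meaningful once one projection is
  exhibited: each component on each subinterval is represented by a polynomial, and the pieces are
  glued together.\<close>

lemma L2_proj_is_L2_projection: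
  assumes part: "is_partition T N t" and v: "v \<in> L2_space M T"
  shows "is_L2_projection M N t m v (L2_proj M N t m v)"
proof -
  have sq: "square_integrable (t n) (t (Suc n)) (\<lambda>s. v s $ i)" if "n < N" "i < M" for n i
    using v partition_range[OF part \<open>n < N\<close>] that(2)
    by (auto simp: L2_space_iff intro: square_integrable_subset)
  have "\<exists>q. degree q \<le> m \<and> (\<forall>w. degree w \<le> m \<longrightarrow> poly_integral (t n) (t (Suc n)) (q * w) =
      (LINT s:subinterval t n|lebesgue. v s $ i * poly w s))" if ni: "n < N" "i < M" for n i
  proof (rule poly_projection_exists)
    show "t n < t (Suc n)" by (rule partition_range[OF part \<open>n < N\<close>])
    note int = square_integrable_mult[OF sq[OF ni] square_integrable_poly]
    show "(LINT s:subinterval t n|lebesgue. v s $ i * poly (p + q) s) =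
        (LINT s:subinterval t n|lebesgue. v s $ i * poly p s) +
        (LINT s:subinterval t n|lebesgue. v s $ i * poly q s)" for p q
      using set_integral_add(2)[OF int int] by (simp add: distrib_left)
    show "(LINT s:subinterval t n|lebesgue. v s $ i * poly (smult c p) s) =
        c * (LINT s:subinterval t n|lebesgue. v s $ i * poly p s)" for c p
      by (simp add: mult.left_commute)
  qed
  then obtain q where q: "\<And>n i. n < N \<Longrightarrow> i < M \<Longrightarrow> degree (q n i) \<le> m"
    "\<And>n i w. n < N \<Longrightarrow> i < M \<Longrightarrow> degree w \<le> m \<Longrightarrow>
      poly_integral (t n) (t (Suc n)) (q n i * w) = (LINT s:subinterval t n|lebesgue. v s $ i * poly w s)"
    by metis
  \<comment> \<open>The open subintervals are disjoint, so \<open>THE\<close> finds the right index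
    inside each of them; at all other points the value is arbitrary and no integral or membership
    condition sees it.\<close>
  define u where "u s = Matrix.vec M (\<lambda>i. poly (q (THE n. n < N \<and> s \<in> subinterval t n) i) s)" for s
  have u: "u s = Matrix.vec M (\<lambda>i. poly (q n i) s)" if "n < N" "s \<in> subinterval t n" for n s
  proof -
    have "(THE n. n < N \<and> s \<in> subinterval t n) = n"
      using that partition_disjoint[OF part] by (intro the_equality) blast+
    then show ?thesis by (simp add: u_def)
  qed
  have carr: "u s \<in> carrier_vec M" for s by (simp add: u_def)
  have "is_L2_projection M N t m v u"
    unfolding is_L2_projection_def
  proof (intro allI impI conjI ballI)
    fix n assume n: "n < N"
    show "u \<in> poly_on M m (subinterval t n)"
      using u[OF n] q(1)[OF n] by (auto simp: poly_on_def carr)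
    fix w assume w: "w \<in> poly_on M m (subinterval t n)"
    then obtain p where p: "\<And>i. i < M \<Longrightarrow> degree (p i) \<le> m"
        "\<And>i s. i < M \<Longrightarrow> s \<in> subinterval t n \<Longrightarrow> w s $ i = poly (p i) s"
      unfolding poly_on_def mem_Collect_eq by metis
    have wc: "w s \<in> carrier_vec M" if "s \<in> subinterval t n" for s
      using w that by (simp add: poly_on_def)
    have "(LINT s:subinterval t n|lebesgue. u s \<bullet> w s) =
        (LINT s:subinterval t n|lebesgue. Matrix.vec M (\<lambda>i. poly (q n i) s) \<bullet> w s)"
      by (intro set_lebesgue_integral_cong) (auto simp: u[OF n])
    also have "\<dots> = (\<Sum>i<M. LINT s:subinterval t n|lebesgue. Matrix.vec M (\<lambda>i. poly (q n i) s) $ i * poly (p i) s)"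
      using wc p(2) by (intro integral_scalar_prod) (auto intro: square_integrable_poly)
    also have "\<dots> = (\<Sum>i<M. LINT s:subinterval t n|lebesgue. v s $ i * poly (p i) s)"
      using q(2)[OF n _ p(1)] by (intro sum.cong) (auto simp: poly_integral_def)
    also have "\<dots> = (LINT s:subinterval t n|lebesgue. v s \<bullet> w s)"
      using wc p(2) sq[OF n] by (intro integral_scalar_prod[symmetric]) auto
    finally show "(LINT s:subinterval t n|lebesgue. u s \<bullet> w s) = (LINT s:subinterval t n|lebesgue. v s \<bullet> w s)" .
  qed
  then show ?thesis
    unfolding L2_proj_def by (rule someI[of "is_L2_projection M N t m v"])
qed

text \<open>Makes the projection usable for polynomial calculus: componentwise polynomials with
  componentwise orthogonality, obtained by testing in coordinate directions.\<close>

lemma L2_proj_polys: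
  assumes part: "is_partition T N t" and v: "v \<in> L2_space M T" and n: "n < N"
  obtains p where "\<And>i. i < M \<Longrightarrow> degree (p i) \<le> m"
    and "\<And>s. s \<in> subinterval t n \<Longrightarrow> L2_proj M N t m v s = Matrix.vec M (\<lambda>i. poly (p i) s)"
    and "\<And>i w. i < M \<Longrightarrow> degree w \<le> m \<Longrightarrow> poly_integral (t n) (t (Suc n)) (p i * w) =
      (LINT s:subinterval t n|lebesgue. v s $ i * poly w s)"
proof -
  let ?u = "L2_proj M N t m v"
  have "?u \<in> poly_on M m (subinterval t n)" and
    eq: "\<And>w. w \<in> poly_on M m (subinterval t n) \<Longrightarrow> (LINT s:subinterval t n|lebesgue. ?u s \<bullet> w s) =
      (LINT s:subinterval t n|lebesgue. v s \<bullet> w s)"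
    using L2_proj_is_L2_projection[OF part v, of m] n by (auto simp: is_L2_projection_def)
  then obtain p where p: "\<And>i. i < M \<Longrightarrow> degree (p i) \<le> m"
        "\<And>i s. i < M \<Longrightarrow> s \<in> subinterval t n \<Longrightarrow> ?u s $ i = poly (p i) s"
        and carr: "\<And>s. s \<in> subinterval t n \<Longrightarrow> ?u s \<in> carrier_vec M"
    unfolding poly_on_def mem_Collect_eq by metis
  have u: "?u s = Matrix.vec M (\<lambda>i. poly (p i) s)" if "s \<in> subinterval t n" for s
    using carr[OF that] p(2)[OF _ that] by (intro eq_vecI) auto
  have "poly_integral (t n) (t (Suc n)) (p i * w) = (LINT s:subinterval t n|lebesgue. v s $ i * poly w s)"
    if i: "i < M" and w: "degree w \<le> m" for i w
  proof -
    \<comment> \<open>The test function is \<open>w\<close> times the unit vector in direction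
      \<open>i\<close>.\<close>
    define W where "W s = Matrix.vec M (\<lambda>j. if j = i then poly w s else 0)" for s
    have "W \<in> poly_on M m (subinterval t n)"
      unfolding poly_on_def mem_Collect_eq
    proof (intro conjI ballI allI impI)
      fix j assume "j < M"
      then show "\<exists>q. degree q \<le> m \<and> (\<forall>s\<in>subinterval t n. W s $ j = poly q s)"
        using w by (intro exI[of _ "if j = i then w else 0"]) (auto simp: W_def)
    qed (simp add: W_def)
    then have "(LINT s:subinterval t n|lebesgue. ?u s \<bullet> W s) = (LINT s:subinterval t n|lebesgue. v s \<bullet> W s)"
      by (rule eq)
    moreover have prod_W: "z \<bullet> W s = z $ i * poly w s" for s z
      using i by (simp add: scalar_prod_def W_def if_distrib[of "\<lambda>x. _ * x"] cong: if_cong)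
    moreover have "(LINT s:subinterval t n|lebesgue. ?u s $ i * poly w s) =
        (LINT s:subinterval t n|lebesgue. poly (p i * w) s)"
      using p(2)[OF i] by (intro set_lebesgue_integral_cong) auto
    ultimately show ?thesis by (simp add: poly_integral_def)
  qed
  with p(1) u that show thesis by blast
qed

section \<open>Norms in components, and the quadratic form of the matrix\<close>

lemma eucl_norm_square:
  assumes "v \<in> carrier_vec M"
  shows "(eucl_norm v)\<^sup>2 = (\<Sum>i<M. (v $ i)\<^sup>2)"
  using assms by (simp add: eucl_norm_def scalar_prod_def lessThan_atLeast0 sum_nonneg power2_eq_square)

lemma eucl_norm_nonneg: "0 \<le> eucl_norm v"
  by (simp add: eucl_norm_def scalar_prod_def sum_nonneg)

lemma L2_norm_nonneg: "0 \<le> L2_norm T v"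
  unfolding L2_norm_def set_lebesgue_integral_def
  by (intro real_sqrt_ge_zero Bochner_Integration.integral_nonneg) simp

lemma L2_norm_square:
  assumes part: "is_partition T N t" and v: "v \<in> L2_space M T"
  shows "(L2_norm T v)\<^sup>2 = (\<Sum>n<N. \<Sum>i<M. LINT s:subinterval t n|lebesgue. (v s $ i)\<^sup>2)"
proof -
  have int: "set_integrable lebesgue {0<..<T} (\<lambda>s. (v s $ i)\<^sup>2)" if "i < M" for i
    using v that by (simp add: L2_space_def)
  have "(L2_norm T v)\<^sup>2 = (LINT s:{0<..<T}|lebesgue. (eucl_norm (v s))\<^sup>2)"
    unfolding L2_norm_def by (simp add: set_lebesgue_integral_def)
  also have "\<dots> = (LINT s:{0<..<T}|lebesgue. \<Sum>i<M. (v s $ i)\<^sup>2)"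
    using v by (intro set_lebesgue_integral_cong) (auto simp: L2_space_def eucl_norm_square)
  also have "\<dots> = (\<Sum>i<M. LINT s:{0<..<T}|lebesgue. (v s $ i)\<^sup>2)"
    using int unfolding set_lebesgue_integral_def scaleR_sum_right set_integrable_def
    by (intro Bochner_Integration.integral_sum) auto
  also have "\<dots> = (\<Sum>i<M. \<Sum>n<N. LINT s:subinterval t n|lebesgue. (v s $ i)\<^sup>2)"
    using int by (intro sum.cong refl partition_integral[OF part]) auto
  also have "\<dots> = (\<Sum>n<N. \<Sum>i<M. LINT s:subinterval t n|lebesgue. (v s $ i)\<^sup>2)"
    by (rule sum.swap)
  finally show ?thesis .
qed

text \<open>A matrix and its transpose have the same quadratic form, so that of
  \<open>D + transpose_mat D\<close> is twice that of \<open>D\<close>. The energy estimate uses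
  \<open>D\<close> only through this sign, so its size enters no constant.\<close>

lemma neg_semidef_symmetrized:
  assumes D: "D \<in> carrier_mat M M" and neg: "neg_semidef M (D + transpose_mat D)"
  shows "(\<Sum>i<M. x i * (\<Sum>j<M. D $$ (i, j) * x j)) \<le> 0"
proof -
  define v where "v = Matrix.vec M x"
  have v: "v \<in> carrier_vec M" by (simp add: v_def)
  have "v \<bullet> ((D + transpose_mat D) *\<^sub>v v) = v \<bullet> (D *\<^sub>v v) + v \<bullet> (transpose_mat D *\<^sub>v v)"
    using D v by (simp add: add_mult_distrib_mat_vec[of _ M M] scalar_prod_add_distrib[of _ M])
  also have "v \<bullet> (transpose_mat D *\<^sub>v v) = v \<bullet> (D *\<^sub>v v)"
    using transpose_vec_mult_scalar[OF D v v] D v comm_scalar_prod[of v M "transpose_mat D *\<^sub>v v"] by auto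
  finally have "v \<bullet> (D *\<^sub>v v) \<le> 0"
    using neg v by (auto simp: neg_semidef_def)
  also have "v \<bullet> (D *\<^sub>v v) = (\<Sum>i<M. x i * (\<Sum>j<M. D $$ (i, j) * x j))"
    using D by (simp add: scalar_prod_def v_def lessThan_atLeast0)
  finally show ?thesis .
qed

subsection \<open>Stability\<close>

text \<open>In the application \<open>E n\<close> is the squared norm at a node, \<open>a n\<close>
  and \<open>\<rho> n\<close> are the squared norms of solution and source on one interval, and
  \<open>X\<close> and \<open>P\<close> the global norms. The hypothesis \<open>est\<close> is used
  with three weights: \<open>T - s\<close>, the constant 1, and
  \<open>t (Suc n) - s\<close>.\<close>

lemma discrete_stability:
  fixes E a \<rho> t :: "nat \<Rightarrow> real"
  assumes part: "is_partition T N t" and T: "0 < T"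
    and nonneg: "\<And>n. 0 \<le> E n" "\<And>n. 0 \<le> a n" "\<And>n. 0 \<le> \<rho> n" "0 \<le> X" "0 \<le> P"
    and X: "X\<^sup>2 = (\<Sum>n<N. a n)" and P: "P\<^sup>2 = (\<Sum>n<N. \<rho> n)"
    and est: "\<And>n \<epsilon> k c \<Phi>. \<lbrakk>n < N; 0 < \<epsilon>; 0 \<le> k;
        \<And>s. s \<in> subinterval t n \<Longrightarrow> 0 \<le> c - k * s \<and> c - k * s \<le> \<Phi>\<rbrakk> \<Longrightarrow>
      (c - k * t (Suc n)) * E (Suc n) - (c - k * t n) * E n + k * a n \<le> \<Phi> * (\<epsilon> * \<rho> n + a n / \<epsilon>)"
  shows "X \<le> sqrt T * sqrt (E 0) + 2 * T * P"
    and "n < N \<Longrightarrow> a n \<le> (t (Suc n) - t n) * (sqrt (E 0) + 4 * sqrt T * P)\<^sup>2"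
proof -
  have t0: "t 0 = 0" "t N = T" using part by (auto simp: is_partition_def)
  \<comment> \<open>One affine weight is used on all intervals, so the node terms cancel in pairs
    and the initial one has weight \<open>c\<close> because \<open>t 0 = 0\<close>. Nonnegativity
    allows the partial sums on the right to be completed to \<open>N\<close>.\<close>
  have telescope: "(c - k * t m) * E m - c * E 0 + k * (\<Sum>n<m. a n) \<le> \<Phi> * (\<epsilon> * P\<^sup>2 + X\<^sup>2 / \<epsilon>)"
    if "m \<le> N" "0 < \<epsilon>" "0 \<le> k" "0 \<le> \<Phi>" and w: "\<And>s. s \<in> {0<..<T} \<Longrightarrow> 0 \<le> c - k * s \<and> c - k * s \<le> \<Phi>"
    for m \<epsilon> k c \<Phi>
  proof -
    have "(c - k * t j) * E j - c * E 0 + k * (\<Sum>n<j. a n) \<le> \<Phi> * (\<epsilon> * (\<Sum>n<j. \<rho> n) + (\<Sum>n<j. a n) / \<epsilon>)"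
      if "j \<le> m" for j
      using that
    proof (induction j)
      case (Suc j)
      then have j: "j < N" using \<open>m \<le> N\<close> by simp
      have "(c - k * t (Suc j)) * E (Suc j) - (c - k * t j) * E j + k * a j \<le> \<Phi> * (\<epsilon> * \<rho> j + a j / \<epsilon>)"
        using partition_range[OF part j] by (intro est j \<open>0 < \<epsilon>\<close> \<open>0 \<le> k\<close> w) auto
      moreover have "(c - k * t j) * E j - c * E 0 + k * (\<Sum>n<j. a n)
          \<le> \<Phi> * (\<epsilon> * (\<Sum>n<j. \<rho> n) + (\<Sum>n<j. a n) / \<epsilon>)"
        using Suc by simp
      moreover have "k * (\<Sum>n<Suc j. a n) = k * (\<Sum>n<j. a n) + k * a j"
        by (simp add: distrib_left)
      moreover have "\<Phi> * (\<epsilon> * (\<Sum>n<Suc j. \<rho> n) + (\<Sum>n<Suc j. a n) / \<epsilon>) =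
          \<Phi> * (\<epsilon> * (\<Sum>n<j. \<rho> n) + (\<Sum>n<j. a n) / \<epsilon>) + \<Phi> * (\<epsilon> * \<rho> j + a j / \<epsilon>)"
        by (simp only: sum.lessThan_Suc distrib_left add_divide_distrib)
      ultimately show ?case by linarith
    qed (simp add: t0)
    from this[of m] have "(c - k * t m) * E m - c * E 0 + k * (\<Sum>n<m. a n)
        \<le> \<Phi> * (\<epsilon> * (\<Sum>n<m. \<rho> n) + (\<Sum>n<m. a n) / \<epsilon>)"
      by simp
    also have "\<dots> \<le> \<Phi> * (\<epsilon> * P\<^sup>2 + X\<^sup>2 / \<epsilon>)"
      unfolding X P using that nonneg
      by (intro mult_left_mono add_mono divide_right_mono sum_mono2) auto
    finally show ?thesis .
  qed
  define A where "A = sqrt (E 0)"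
  have A: "0 \<le> A" "A\<^sup>2 = E 0" using nonneg by (auto simp: A_def)
  define \<sigma> where "\<sigma> = sqrt T"
  have \<sigma>: "0 < \<sigma>" "T = \<sigma>\<^sup>2" using T by (auto simp: \<sigma>_def)
  \<comment> \<open>The weight \<open>T - s\<close> vanishes at the final node, which removes the
    unknown final energy, and is bounded by \<open>T\<close>.\<close>
  have "(X\<^sup>2 - T * E 0) / T \<le> 2 * P * X"
  proof (rule le_twice_mult_if_young)
    fix \<epsilon> :: real assume "0 < \<epsilon>"
    then have "X\<^sup>2 - T * E 0 \<le> T * (\<epsilon> * P\<^sup>2 + X\<^sup>2 / \<epsilon>)"
      using telescope[of N \<epsilon> 1 T T] T by (simp add: t0 flip: X)
    then show "(X\<^sup>2 - T * E 0) / T \<le> \<epsilon> * P\<^sup>2 + X\<^sup>2 / \<epsilon>"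
      using T by (simp add: pos_divide_le_eq mult.commute)
  qed (use nonneg in auto)
  then have "X\<^sup>2 - T * E 0 \<le> 2 * P * X * T"
    using T by (simp add: pos_divide_le_eq)
  moreover have "(\<sigma> * A)\<^sup>2 = T * E 0"
    by (simp add: power_mult_distrib \<sigma>(2) A(2))
  ultimately have "X\<^sup>2 \<le> (\<sigma> * A)\<^sup>2 + 2 * T * P * X"
    by (simp add: mult_ac)
  then have X_le: "X \<le> \<sigma> * A + 2 * T * P"
    by (rule le_add_if_square_le[rotated 2]) (use A(1) \<sigma>(1) T nonneg(5) in simp_all)
  then show "X \<le> sqrt T * sqrt (E 0) + 2 * T * P"
    by (simp add: A_def \<sigma>_def)
  \<comment> \<open>With weight 1 the growth of the energy is at most \<open>2 * P * X\<close>, and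
    the bound on \<open>X\<close> just obtained is inserted.\<close>
  have node: "sqrt (E m) \<le> A + 2 * \<sigma> * P" if "m \<le> N" for m
  proof (rule real_le_lsqrt)
    have "E m - E 0 \<le> 2 * P * X"
    proof (rule le_twice_mult_if_young)
      fix \<epsilon> :: real assume "0 < \<epsilon>"
      with telescope[of m \<epsilon> 0 1 1] that show "E m - E 0 \<le> \<epsilon> * P\<^sup>2 + X\<^sup>2 / \<epsilon>" by simp
    qed (use nonneg in auto)
    also have "\<dots> \<le> 2 * P * (\<sigma> * A + 2 * T * P)"
      using X_le nonneg by (intro mult_left_mono) auto
    \<comment> \<open>The nonnegative term is added to complete the square of
      \<open>A + 2 * \<sigma> * P\<close>.\<close>
    also have "\<dots> \<le> 2 * P * (\<sigma> * A + 2 * T * P) + 2 * (P * \<sigma> * A)"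
      using A(1) \<sigma>(1) nonneg(5) by simp
    also have "\<dots> = (A + 2 * \<sigma> * P)\<^sup>2 - E 0"
      by (simp add: \<sigma>(2) power2_eq_square algebra_simps flip: A(2))
    finally show "E m \<le> (A + 2 * \<sigma> * P)\<^sup>2" by simp
  qed (use A(1) \<sigma>(1) nonneg in simp_all)
  show "a n \<le> (t (Suc n) - t n) * (sqrt (E 0) + 4 * sqrt T * P)\<^sup>2" if n: "n < N"
  proof -
    define h where "h = sqrt (t (Suc n) - t n)"
    have h: "0 < h" "t (Suc n) - t n = h\<^sup>2" "h \<le> \<sigma>"
      using partition_range[OF part n] by (auto simp: h_def \<sigma>_def)
    define x where "x = sqrt (a n)"
    have x: "0 \<le> x" "a n = x\<^sup>2" using nonneg by (auto simp: x_def)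
    have "(a n - h\<^sup>2 * E n) / h\<^sup>2 \<le> 2 * P * x"
    proof (rule le_twice_mult_if_young)
      fix \<epsilon> :: real assume \<epsilon>: "0 < \<epsilon>"
      \<comment> \<open>The weight \<open>t (Suc n) - s\<close> vanishes at the right node and is at
        most the interval length, so \<open>a n\<close> inherits that length as a factor.\<close>
      have "(t (Suc n) - 1 * t (Suc n)) * E (Suc n) - (t (Suc n) - 1 * t n) * E n + 1 * a n
          \<le> h\<^sup>2 * (\<epsilon> * \<rho> n + a n / \<epsilon>)"
        by (intro est n \<epsilon>) (auto simp flip: h(2))
      also have "\<dots> \<le> h\<^sup>2 * (\<epsilon> * P\<^sup>2 + a n / \<epsilon>)"
        unfolding P using n \<epsilon> nonneg by (intro mult_left_mono add_right_mono member_le_sum) auto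
      finally show "(a n - h\<^sup>2 * E n) / h\<^sup>2 \<le> \<epsilon> * P\<^sup>2 + x\<^sup>2 / \<epsilon>"
        using h(1) by (simp add: pos_divide_le_eq mult.commute h(2) x(2))
    qed (use nonneg(5) x(1) in simp_all)
    then have "a n - h\<^sup>2 * E n \<le> 2 * P * x * h\<^sup>2"
      using h(1) by (simp add: pos_divide_le_eq)
    moreover have "(h * sqrt (E n))\<^sup>2 = h\<^sup>2 * E n"
      using nonneg by (simp add: power_mult_distrib)
    ultimately have "x\<^sup>2 \<le> (h * sqrt (E n))\<^sup>2 + 2 * h\<^sup>2 * P * x"
      by (simp add: x(2) mult_ac)
    then have "x \<le> h * sqrt (E n) + 2 * h\<^sup>2 * P"
      by (rule le_add_if_square_le[rotated 2]) (use h(1) nonneg(1,5) in simp_all)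
    also have "\<dots> = h * (sqrt (E n) + 2 * h * P)"
      by (simp add: power2_eq_square algebra_simps)
    \<comment> \<open>Of the final 4, one 2 comes from the node bound and one from the source on
      this interval, where \<open>h \<le> \<sigma>\<close>.\<close>
    also have "\<dots> \<le> h * ((A + 2 * \<sigma> * P) + 2 * \<sigma> * P)"
      using h(1,3) node[of n] n nonneg(5) by (intro mult_left_mono add_mono mult_right_mono) simp_all
    also have "\<dots> = h * (A + 4 * \<sigma> * P)" by simp
    finally have "x\<^sup>2 \<le> (h * (A + 4 * \<sigma> * P))\<^sup>2"
      using x(1) by (rule power_mono)
    then show ?thesis
      by (simp add: x(2) h(2) power_mult_distrib A_def \<sigma>_def)
  qed
qed

section \<open>Polynomial pieces of the discrete solution\<close>

lemma poly_eq_on_closed_interval: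
  fixes f :: "real \<Rightarrow> real"
  assumes "a < b" "continuous_on {a..b} f" and eq: "\<And>s. s \<in> {a<..<b} \<Longrightarrow> f s = poly p s"
    and "s \<in> {a..b}"
  shows "f s = poly p s"
proof -
  have "f s - poly p s = 0"
  proof (rule continuous_constant_on_closure[where f = "\<lambda>s. f s - poly p s" and S = "{a<..<b}"])
    have closure: "closure {a<..<b} = {a..b}" using assms(1) by simp
    show "continuous_on (closure {a<..<b}) (\<lambda>s. f s - poly p s)"
      unfolding closure by (intro continuous_on_diff assms(2) continuous_on_poly continuous_on_id)
    show "s \<in> closure {a<..<b}"
      unfolding closure by (rule assms(4))
    show "f x - poly p x = 0" if "x \<in> {a<..<b}" for x
      by (simp only: eq[OF that] diff_self)
  qed
  then show ?thesis by simp
qed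

lemma V_space_subset_L2_space: "V_space M T N t r \<subseteq> L2_space M T"
proof
  fix v assume "v \<in> V_space M T N t r"
  then have "\<forall>s\<in>{0..T}. v s \<in> carrier_vec M"
    and "\<And>i. i < M \<Longrightarrow> continuous_on {0..T} (\<lambda>s. v s $ i)"
    by (simp_all add: V_space_def)
  then show "v \<in> L2_space M T"
    by (simp add: L2_space_iff square_integrable_continuous)
qed

text \<open>Continuity carries the polynomial representation from the open subinterval to its
  closure. Both neighbouring polynomials thus give the same value at a node, as the telescoping of
  energies requires.\<close>

lemma V_space_polys:
  assumes part: "is_partition T N t" and Y: "Y \<in> V_space M T N t r" and n: "n < N"
  obtains y where "\<And>i. i < M \<Longrightarrow> degree (y i) \<le> r"
    and "\<And>i s. i < M \<Longrightarrow> s \<in> {t n..t (Suc n)} \<Longrightarrow> Y s $ i = poly (y i) s"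
proof -
  have "Y \<in> poly_on M r (subinterval t n)"
    and cont: "\<And>i. i < M \<Longrightarrow> continuous_on {0..T} (\<lambda>s. Y s $ i)"
    using Y n by (auto simp: V_space_def)
  then obtain y where y: "\<And>i. i < M \<Longrightarrow> degree (y i) \<le> r"
      "\<And>i s. i < M \<Longrightarrow> s \<in> subinterval t n \<Longrightarrow> Y s $ i = poly (y i) s"
    unfolding poly_on_def mem_Collect_eq by metis
  have "Y s $ i = poly (y i) s" if "i < M" "s \<in> {t n..t (Suc n)}" for i s
  proof (rule poly_eq_on_closed_interval[OF _ _ y(2)[OF that(1)] that(2)])
    show "t n < t (Suc n)" by (rule partition_range[OF part n])
    show "continuous_on {t n..t (Suc n)} (\<lambda>s. Y s $ i)"
      using partition_range[OF part n] by (intro continuous_on_subset[OF cont[OF that(1)]]) auto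
  qed
  with y(1) that show thesis by blast
qed

text \<open>On each interval the solution and the two projections are replaced by polynomials
  \<open>y\<close>, \<open>u\<close>, \<open>g\<close>; the local energy estimate then supplies the
  hypothesis of the discrete argument. Constants are kept explicit.\<close>

lemma ctg_stability:
  assumes T: "0 < T" and part: "is_partition T N t" and D: "D \<in> carrier_mat M M"
    and neg: "neg_semidef M (D + transpose_mat D)" and r: "1 \<le> r"
    and R: "R \<in> L2_space M T" and sol: "ctg_solution M T N t r D Y0 R Y"
  shows "L2_norm T Y \<le> sqrt T * eucl_norm Y0 + 2 * T * L2_norm T R"
    and "s \<in> {0..T} \<Longrightarrow> eucl_norm (Y s) \<le> (real r + 1) * (eucl_norm Y0 + 4 * sqrt T * L2_norm T R)"
proof -
  obtain m where m: "r = Suc m" using r by (cases r) auto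
  have V: "Y \<in> V_space M T N t r" and init: "Y 0 = Y0"
    and ode: "\<And>n s i. n < N \<Longrightarrow> s \<in> subinterval t n \<Longrightarrow> i < M \<Longrightarrow> ((\<lambda>x. Y x $ i) has_real_derivative
           (D *\<^sub>v L2_proj M N t m Y s + L2_proj M N t m R s) $ i) (at s)"
    using sol by (auto simp: ctg_solution_def m)
  have Y: "Y \<in> L2_space M T" using V V_space_subset_L2_space by blast
  have carr: "Y s \<in> carrier_vec M" if "s \<in> {0..T}" for s
    using V that by (simp add: V_space_def)
  \<comment> \<open>Bundling the requirements into a predicate allows polynomials to be chosen for
    all intervals at once; \<open>is_proj\<close> serves the same purpose for both
    projections.\<close>
  define is_rep where "is_rep n p \<longleftrightarrow> (\<forall>i<M. degree (p i) \<le> r) \<and>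
      (\<forall>i<M. \<forall>s\<in>{t n..t (Suc n)}. Y s $ i = poly (p i) s)" for n p
  have "\<exists>p. is_rep n p" if "n < N" for n
    unfolding is_rep_def by (rule V_space_polys[OF part V that]) blast
  then obtain y where "\<And>n. n < N \<Longrightarrow> is_rep n (y n)"
    by metis
  then have y: "\<And>n i. n < N \<Longrightarrow> i < M \<Longrightarrow> degree (y n i) \<le> r"
      "\<And>n i s. n < N \<Longrightarrow> i < M \<Longrightarrow> s \<in> {t n..t (Suc n)} \<Longrightarrow> Y s $ i = poly (y n i) s"
    unfolding is_rep_def by blast+
  define is_proj where "is_proj v n p \<longleftrightarrow> (\<forall>i<M. degree (p i) \<le> m) \<and>
      (\<forall>s\<in>subinterval t n. L2_proj M N t m v s = Matrix.vec M (\<lambda>i. poly (p i) s)) \<and>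
      (\<forall>i<M. \<forall>w. degree w \<le> m \<longrightarrow> poly_integral (t n) (t (Suc n)) (p i * w) =
         (LINT s:subinterval t n|lebesgue. v s $ i * poly w s))" for v n p
  have proj: "\<exists>p. is_proj v n p" if "v \<in> L2_space M T" "n < N" for v n
    unfolding is_proj_def by (rule L2_proj_polys[OF part that, of m]) blast
  obtain u where "\<And>n. n < N \<Longrightarrow> is_proj Y n (u n)"
    using proj[OF Y] by metis
  then have u: "\<And>n i. n < N \<Longrightarrow> i < M \<Longrightarrow> degree (u n i) \<le> m"
      "\<And>n s. n < N \<Longrightarrow> s \<in> subinterval t n \<Longrightarrow> L2_proj M N t m Y s = Matrix.vec M (\<lambda>i. poly (u n i) s)"
      "\<And>n i w. n < N \<Longrightarrow> i < M \<Longrightarrow> degree w \<le> m \<Longrightarrow> poly_integral (t n) (t (Suc n)) (u n i * w) =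
         (LINT s:subinterval t n|lebesgue. Y s $ i * poly w s)"
    unfolding is_proj_def by blast+
  obtain g where "\<And>n. n < N \<Longrightarrow> is_proj R n (g n)"
    using proj[OF R] by metis
  then have g: "\<And>n i. n < N \<Longrightarrow> i < M \<Longrightarrow> degree (g n i) \<le> m"
      "\<And>n s. n < N \<Longrightarrow> s \<in> subinterval t n \<Longrightarrow> L2_proj M N t m R s = Matrix.vec M (\<lambda>i. poly (g n i) s)"
      "\<And>n i w. n < N \<Longrightarrow> i < M \<Longrightarrow> degree w \<le> m \<Longrightarrow> poly_integral (t n) (t (Suc n)) (g n i * w) =
         (LINT s:subinterval t n|lebesgue. R s $ i * poly w s)"
    unfolding is_proj_def by blast+
  have orth: "poly_integral (t n) (t (Suc n)) (u n i * w) = poly_integral (t n) (t (Suc n)) (y n i * w)"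
    if "n < N" "i < M" "degree w \<le> m" for n i w
    unfolding u(3)[OF that] unfolding poly_integral_def
    using y(2)[OF that(1,2)] by (intro set_lebesgue_integral_cong) auto
  \<comment> \<open>At interior points the derivative of the component is unique, and agreement on
    an open interval makes the equation an identity of polynomials.\<close>
  have poly_ode: "pderiv (y n i) = (\<Sum>j<M. smult (D $$ (i, j)) (u n j)) + g n i" if ni: "n < N" "i < M" for n i
  proof (rule poly_eq_on_open_interval)
    show "t n < t (Suc n)" by (rule partition_range[OF part ni(1)])
    fix s assume s: "s \<in> subinterval t n"
    have "((\<lambda>x. Y x $ i) has_real_derivative poly (pderiv (y n i)) s) (at s)"
      using s y(2)[OF ni]
      by (intro has_field_derivative_transform_within_open[where S = "subinterval t n", OF poly_DERIV]) auto
    then have "poly (pderiv (y n i)) s = (D *\<^sub>v L2_proj M N t m Y s + L2_proj M N t m R s) $ i"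
      using ode[OF ni(1) s ni(2)] by (rule DERIV_unique)
    also have "\<dots> = poly ((\<Sum>j<M. smult (D $$ (i, j)) (u n j)) + g n i) s"
      using D ni(2) by (simp add: u(2)[OF ni(1) s] g(2)[OF ni(1) s] scalar_prod_def poly_sum lessThan_atLeast0)
    finally show "poly (pderiv (y n i)) s = poly ((\<Sum>j<M. smult (D $$ (i, j)) (u n j)) + g n i) s" .
  qed
  define E where "E n = (eucl_norm (Y (t n)))\<^sup>2" for n
  define a where "a n = (\<Sum>i<M. poly_integral (t n) (t (Suc n)) (y n i * y n i))" for n
  define \<rho> where "\<rho> n = (\<Sum>i<M. LINT s:subinterval t n|lebesgue. (R s $ i)\<^sup>2)" for n
  have norm_Y: "(eucl_norm (Y s))\<^sup>2 = (\<Sum>i<M. (poly (y n i) s)\<^sup>2)" if "n < N" "s \<in> {t n..t (Suc n)}" for n s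
  proof -
    have "s \<in> {0..T}" using partition_range[OF part that(1)] that(2) by auto
    then show ?thesis
      using y(2)[OF that(1) _ that(2)] by (simp add: eucl_norm_square[OF carr])
  qed
  have X: "(L2_norm T Y)\<^sup>2 = (\<Sum>n<N. a n)"
    unfolding L2_norm_square[OF part Y] a_def poly_integral_def
    using y(2) by (intro sum.cong refl set_lebesgue_integral_cong) (auto simp: power2_eq_square)
  have P: "(L2_norm T R)\<^sup>2 = (\<Sum>n<N. \<rho> n)"
    unfolding L2_norm_square[OF part R] \<rho>_def ..
  have nonneg: "0 \<le> E n" "0 \<le> a n" "0 \<le> \<rho> n" for n
    by (auto simp: E_def a_def \<rho>_def set_lebesgue_integral_def
        intro!: sum_nonneg poly_integral_square_nonneg Bochner_Integration.integral_nonneg)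
  \<comment> \<open>By Bessel's inequality the projected source may be replaced by \<open>R\<close>
    itself.\<close>
  have g_le: "(\<Sum>i<M. poly_integral (t n) (t (Suc n)) (g n i * g n i)) \<le> \<rho> n" if n: "n < N" for n
    unfolding \<rho>_def
  proof (rule sum_mono)
    fix i assume "i \<in> {..<M}"
    then have i: "i < M" by simp
    have "square_integrable 0 T (\<lambda>s. R s $ i)"
      using R i by (simp add: L2_space_iff)
    then show "poly_integral (t n) (t (Suc n)) (g n i * g n i) \<le> (LINT s:subinterval t n|lebesgue. (R s $ i)\<^sup>2)"
      using partition_range[OF part n]
      by (intro poly_projection_le[OF square_integrable_subset g(1)[OF n i] g(3)[OF n i]]) auto
  qed
  have est: "(c - k * t (Suc n)) * E (Suc n) - (c - k * t n) * E n + k * a n \<le> \<Phi> * (\<epsilon> * \<rho> n + a n / \<epsilon>)"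
    if n: "n < N" and eps: "0 < \<epsilon>" and k: "0 \<le> k"
      and w: "\<And>s. s \<in> subinterval t n \<Longrightarrow> 0 \<le> c - k * s \<and> c - k * s \<le> \<Phi>" for n \<epsilon> k c \<Phi>
  proof -
    have less: "t n < t (Suc n)" by (rule partition_range[OF part n])
    then have "0 \<le> \<Phi>" using w[of "(t n + t (Suc n)) / 2"] by force
    have E: "E n = (\<Sum>i<M. (poly (y n i) (t n))\<^sup>2)" "E (Suc n) = (\<Sum>i<M. (poly (y n i) (t (Suc n)))\<^sup>2)"
      unfolding E_def using less by (intro norm_Y n; simp)+
    have "(c - k * t (Suc n)) * E (Suc n) - (c - k * t n) * E n + k * a n
        \<le> \<Phi> * (\<epsilon> * (\<Sum>i<M. poly_integral (t n) (t (Suc n)) (g n i * g n i)) + a n / \<epsilon>)"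
      unfolding E a_def
    proof (rule local_energy_estimate[OF less eps])
      show "degree (y n i) \<le> Suc m" if "i < M" for i
        using y(1)[OF n that] by (simp add: m)
      show "pderiv (y n i) = (\<Sum>j<M. smult (D $$ (i, j)) (u n j)) + g n i" if "i < M" for i
        by (rule poly_ode[OF n that])
      show "poly_integral (t n) (t (Suc n)) (u n i * w) = poly_integral (t n) (t (Suc n)) (y n i * w)"
        if "i < M" "degree w \<le> m" for i w
        by (rule orth[OF n that])
    qed (use u(1)[OF n] neg_semidef_symmetrized[OF D neg] k w in auto)
    also have "\<dots> \<le> \<Phi> * (\<epsilon> * \<rho> n + a n / \<epsilon>)"
      using \<open>0 \<le> \<Phi>\<close> eps g_le[OF n] by (intro mult_left_mono add_right_mono) auto
    finally show ?thesis .
  qed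
  have E0: "sqrt (E 0) = eucl_norm Y0"
    using part init by (simp add: E_def is_partition_def eucl_norm_nonneg)
  note stab = discrete_stability[OF part T nonneg L2_norm_nonneg L2_norm_nonneg X P]
  show "L2_norm T Y \<le> sqrt T * eucl_norm Y0 + 2 * T * L2_norm T R"
    unfolding E0[symmetric] by (rule stab(1)) (fact est)
  have local_bound: "a n \<le> (t (Suc n) - t n) * (eucl_norm Y0 + 4 * sqrt T * L2_norm T R)\<^sup>2" if "n < N" for n
    unfolding E0[symmetric] by (rule stab(2)) (fact est, fact that)
  show "eucl_norm (Y s) \<le> (real r + 1) * (eucl_norm Y0 + 4 * sqrt T * L2_norm T R)" if s: "s \<in> {0..T}"
  proof -
    obtain n where n: "n < N" "s \<in> {t n..t (Suc n)}"
      by (rule partition_cover[OF part T s])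
    let ?h = "t (Suc n) - t n" and ?B = "eucl_norm Y0 + 4 * sqrt T * L2_norm T R"
    have h: "0 < ?h" using partition_range[OF part n(1)] by simp
    \<comment> \<open>The inverse inequality loses the interval length and the local bound on
      \<open>a n\<close> returns it; the length cancels, so the result is independent of the step
      sizes.\<close>
    have "?h * (eucl_norm (Y s))\<^sup>2 = (\<Sum>i<M. ?h * (poly (y n i) s)\<^sup>2)"
      by (simp only: norm_Y[OF n] sum_distrib_left)
    also have "\<dots> \<le> (\<Sum>i<M. (real r + 1)\<^sup>2 * poly_integral (t n) (t (Suc n)) (y n i * y n i))"
      using h n y(1)[OF n(1)] by (intro sum_mono poly_inverse_inequality) auto
    also have "\<dots> = (real r + 1)\<^sup>2 * a n"
      by (simp only: a_def sum_distrib_left)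
    also have "\<dots> \<le> (real r + 1)\<^sup>2 * (?h * ?B\<^sup>2)"
      by (intro mult_left_mono local_bound n) simp
    also have "\<dots> = ?h * ((real r + 1) * ?B)\<^sup>2"
      by (simp add: power_mult_distrib)
    finally have "(eucl_norm (Y s))\<^sup>2 \<le> ((real r + 1) * ?B)\<^sup>2"
      using h by simp
    moreover have "0 \<le> (real r + 1) * ?B"
      using T L2_norm_nonneg[of T R] eucl_norm_nonneg[of Y0] by (intro mult_nonneg_nonneg add_nonneg_nonneg) auto
    ultimately show ?thesis by (rule power2_le_imp_le)
  qed
qed

theorem theorem5p1:
  shows "\<exists>C>0. \<forall>(M::nat) (T::real) (N::nat) (t::nat \<Rightarrow> real) (D::real mat) (r::nat)
      (Y0::real vec) (R::real \<Rightarrow> real vec) (Y::real \<Rightarrow> real vec).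
    M \<ge> 1 \<longrightarrow> T > 0 \<longrightarrow> is_partition T N t \<longrightarrow>
    D \<in> carrier_mat M M \<longrightarrow>
    transpose_mat D = D \<or> transpose_mat D = - D \<longrightarrow>
    neg_semidef M (D + transpose_mat D) \<longrightarrow>
    r \<ge> 1 \<longrightarrow> Y0 \<in> carrier_vec M \<longrightarrow> R \<in> L2_space M T \<longrightarrow>
    ctg_solution M T N t r D Y0 R Y \<longrightarrow>
      L2_norm T Y \<le> sqrt T * eucl_norm Y0 + C * T * L2_norm T R \<and>
      (SUP s\<in>{0..T}. eucl_norm (Y s))
        \<le> C * real r * (eucl_norm Y0 + sqrt T * L2_norm T R)"
proof (intro exI[of _ 8] conjI allI impI)
  \<comment> \<open>The witness 8 is 2 times 4: \<open>r + 1 \<le> 2 r\<close> gives the 2, and the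
    4 is the factor of the source in the maximum bound. It also dominates the 2 of the first
    estimate.\<close>
  fix M N r :: nat and T :: real and t :: "nat \<Rightarrow> real" and D :: "real mat" and Y0 :: "real vec"
    and R Y :: "real \<Rightarrow> real vec"
  assume T: "0 < T" and r: "1 \<le> r"
    and part: "is_partition T N t" and D: "D \<in> carrier_mat M M" "neg_semidef M (D + transpose_mat D)"
    and R: "R \<in> L2_space M T" and sol: "ctg_solution M T N t r D Y0 R Y"
  note stab = ctg_stability[OF T part D r R sol]
  have P: "0 \<le> L2_norm T R"
    by (rule L2_norm_nonneg)
  have "2 * T * L2_norm T R \<le> 8 * T * L2_norm T R"
    using T P by (intro mult_right_mono) simp_all
  with stab(1) show "L2_norm T Y \<le> sqrt T * eucl_norm Y0 + 8 * T * L2_norm T R"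
    by linarith
  show "(SUP s\<in>{0..T}. eucl_norm (Y s)) \<le> 8 * real r * (eucl_norm Y0 + sqrt T * L2_norm T R)"
  proof (rule cSUP_least)
    show "{0..T} \<noteq> {}" using T by simp
    fix s assume "s \<in> {0..T}"
    then have "eucl_norm (Y s) \<le> (real r + 1) * (eucl_norm Y0 + 4 * sqrt T * L2_norm T R)"
      by (rule stab(2))
    also have "\<dots> \<le> (2 * real r) * (4 * (eucl_norm Y0 + sqrt T * L2_norm T R))"
    proof (rule mult_mono)
      show "real r + 1 \<le> 2 * real r" using r by simp
      show "eucl_norm Y0 + 4 * sqrt T * L2_norm T R \<le> 4 * (eucl_norm Y0 + sqrt T * L2_norm T R)"
        using eucl_norm_nonneg[of Y0] by simp
      show "0 \<le> eucl_norm Y0 + 4 * sqrt T * L2_norm T R"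
        using eucl_norm_nonneg[of Y0] P T by simp
    qed simp
    also have "\<dots> = 8 * real r * (eucl_norm Y0 + sqrt T * L2_norm T R)"
      by (simp add: algebra_simps)
    finally show "eucl_norm (Y s) \<le> 8 * real r * (eucl_norm Y0 + sqrt T * L2_norm T R)" .
  qed
qed simp

end
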